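(* Let $X$ be a Banach space with dual $X^{\ast}$, $C\subset X$ a nonempty closed convex set, $p\ge 2$ a natural number, $f:X\to X^{\ast}$ with $f\in\mathcal{C}^{p+1}(X)$, and $F(x)=f(x)+N_C(x)$. Let $x_0\in X$ satisfy $0\in F(x_0)$, and let $f$ be completely degenerate at $x_0$ up to the order $p$, i.e. $f^{(k)}(x_0)=0$ for $k=1,\ldots,p-1$. Let $\bar h\in X$, and suppose that for some sufficiently small $\varepsilon>0$: 1. $\bar h\in\operatorname{Ker}^pL_h(0)$, meaning that $0\in L_{t\bar h}(0)$, equivalently $$0\in f^{(p)}(x_0)[t\bar h]^p+N_C(x_0+t\bar h),\qquad \forall t\in[0,\varepsilon);$$ 2. (strong $p$-regularity of $F$ along $\bar h$ at $x_0$) there is a constant $c>0$ such that $$H\left(L_{t\bar h}^{-1}(y_1),L_{t\bar h}^{-1}(y_2)\right)\le\frac{c}{t^{p-1}}\,\|y_1-y_2\|\qquad\forall y_1,y_2\in X^{\ast},\ \forall t\in(0,\varepsilon).$$ Then $\bar h\in TM_F(x_0)$.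
   Context: The normal cone mapping $N_C:X\rightrightarrows X^{\ast}$ is $N_C(x)=\{z\in X^{\ast}:\langle z,c-x\rangle\le 0\ \ \forall c\in C\}$ if $x\in C$, and $N_C(x)=\emptyset$ if $x\notin C$. $f^{(k)}(x_0)$ is the $k$-th Fréchet derivative, a continuous symmetric $k$-multilinear mapping. For a symmetric $p$-multilinear mapping $B$, $B[h]^p=B(h,\ldots,h)$, and $B[h]^{p-1}[v]=B(h,\ldots,h,v)$ with $h$ repeated $p-1$ times. For $h\in X$ the set-valued mapping $L_h:X\rightrightarrows X^{\ast}$ is $$L_h(x)=\frac{1}{(p-1)!}f^{(p)}(x_0)[h]^{p-1}[h+x]+N_C(x_0+h+x),$$ and $L_h^{-1}(y)=\{x\in X:y\in L_h(x)\}$. The Hausdorff distance between sets $S_1,S_2$ is $H(S_1,S_2)=\max\{\sup_{x\in S_1}\operatorname{dist}(x,S_2),\ \sup_{y\in S_2}\operatorname{dist}(y,S_1)\}$. The solution set is $M_F(x_0)=\{z\in X:0\in f(z)+N_C(z)\}$. A vector $h\in X$ belongs to the tangent cone $TM_F(x_0)$ of $M_F(x_0)$ at $x_0$ if there exist a sufficiently small $\varepsilon>0$ and a mapping $w:X\to X$ such that for all $t\in[0,\varepsilon)$ $$0\in f(x_0+th+w(th))+N_C(x_0+th+w(th)),$$ and $\|w(th)\|=o(t)$ as $t\to 0^+$.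
   Formalization: The formal theorem adds the hypothesis ⟨f(x_0), h̄⟩ = 0; without it the claim fails (e.g. on H×ℝ with C = H×[0,∞), f(u,s) = n + sAu, n(u,s) = s, A: H → X* an isomorphism), and it is necessary for h̄ to be tangent. *)

theory Defs
  imports "HOL-Analysis.Analysis" "HOL-Library.Landau_Symbols"
begin

section \<open>Higher Frechet derivatives\<close>

text \<open>
  A map of \<open>k\<close> arguments is represented by a function on lists, of which only the values on
  lists of length \<open>k\<close> matter. The argument at the head of the list belongs to the derivative that
  was taken last.
\<close>

primrec fderiv :: "nat \<Rightarrow> ('a::real_normed_vector \<Rightarrow> 'b::real_normed_vector) \<Rightarrow> 'a \<Rightarrow> 'a list \<Rightarrow> 'b"
where
  "fderiv 0 f x hs = f x"
| "fderiv (Suc k) f x hs = frechet_derivative (\<lambda>y. fderiv k f y (tl hs)) (at x) (hd hs)"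

definition bounded_multilinear ::
  "nat \<Rightarrow> ('a::real_normed_vector list \<Rightarrow> 'b::real_normed_vector) \<Rightarrow> bool"
where
  "bounded_multilinear k m \<longleftrightarrow>
    (\<forall>hs i. length hs = k \<and> i < k \<longrightarrow> linear (\<lambda>v. m (hs[i := v]))) \<and>
    (\<exists>K. \<forall>hs. length hs = k \<longrightarrow> norm (m hs) \<le> K * (\<Prod>h\<leftarrow>hs. norm h))"

text \<open>
  \<open>fderiv\<close> by itself only records derivatives in each fixed list of directions. The class
  \<open>C\<^sup>n\<close> asks for differentiability and continuity with respect to the operator norm on bounded
  multilinear maps, where \<open>m\<close> has norm at most \<open>K\<close> iff
  \<open>norm (m hs) \<le> K * (\<Prod>h\<leftarrow>hs. norm h)\<close> for all \<open>hs\<close>.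
\<close>

definition C_diff :: "nat \<Rightarrow> ('a::real_normed_vector \<Rightarrow> 'b::real_normed_vector) \<Rightarrow> bool" where
  "C_diff n f \<longleftrightarrow>
    (\<forall>k\<le>n. \<forall>x. bounded_multilinear k (fderiv k f x)) \<and>
    (\<forall>k<n. \<forall>x. \<forall>e>0. \<forall>\<^sub>F y in at x. \<forall>hs. length hs = k \<longrightarrow>
        norm (fderiv k f y hs - fderiv k f x hs - fderiv (Suc k) f x ((y - x) # hs))
          \<le> e * norm (y - x) * (\<Prod>h\<leftarrow>hs. norm h)) \<and>
    (\<forall>x. \<forall>e>0. \<forall>\<^sub>F y in at x. \<forall>hs. length hs = n \<longrightarrow>
        norm (fderiv n f y hs - fderiv n f x hs) \<le> e * (\<Prod>h\<leftarrow>hs. norm h))"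

definition completely_degenerate ::
  "nat \<Rightarrow> ('a::real_normed_vector \<Rightarrow> 'b::real_normed_vector) \<Rightarrow> 'a \<Rightarrow> bool"
where
  "completely_degenerate p f x0 \<longleftrightarrow>
    (\<forall>k\<in>{1..p-1}. \<forall>hs. length hs = k \<longrightarrow> fderiv k f x0 hs = 0)"


section \<open>Generalized equations\<close>

definition normal_cone :: "'a::real_normed_vector set \<Rightarrow> 'a \<Rightarrow> ('a \<Rightarrow>\<^sub>L real) set" where
  "normal_cone C x = (if x \<in> C then {z. \<forall>c\<in>C. blinfun_apply z (c - x) \<le> 0} else {})"

definition gen_map ::
  "('a::real_normed_vector \<Rightarrow> 'a \<Rightarrow>\<^sub>L real) \<Rightarrow> 'a set \<Rightarrow> 'a \<Rightarrow> ('a \<Rightarrow>\<^sub>L real) set"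
where
  "gen_map f C x = (\<lambda>z. f x + z) ` normal_cone C x"

definition solution_set :: "('a \<Rightarrow> 'b::zero set) \<Rightarrow> 'a set" where
  "solution_set F = {z. 0 \<in> F z}"

definition set_inverse :: "('a \<Rightarrow> 'b set) \<Rightarrow> 'b \<Rightarrow> 'a set" where
  "set_inverse L y = {x. y \<in> L x}"

definition L_map ::
  "nat \<Rightarrow> ('a::real_normed_vector \<Rightarrow> 'a \<Rightarrow>\<^sub>L real) \<Rightarrow> 'a set \<Rightarrow> 'a \<Rightarrow> 'a \<Rightarrow> 'a \<Rightarrow> ('a \<Rightarrow>\<^sub>L real) set"
where
  "L_map p f C x0 h x =
    (\<lambda>z. (1 / fact (p - 1)) *\<^sub>R fderiv p f x0 (replicate (p - 1) h @ [h + x]) + z)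
      ` normal_cone C (x0 + h + x)"

text \<open>
  The value is extended real: in \<open>ennreal\<close> the distance to the empty set is \<open>\<infinity>\<close>, so a finite
  bound against a nonempty set forces the other set to be nonempty.
\<close>

definition hausdorff_distance :: "'a::metric_space set \<Rightarrow> 'a set \<Rightarrow> ennreal" where
  "hausdorff_distance S1 S2 =
    max (SUP x\<in>S1. INF y\<in>S2. ennreal (dist x y)) (SUP y\<in>S2. INF x\<in>S1. ennreal (dist y x))"

definition strongly_p_regular ::
  "nat \<Rightarrow> ('a::real_normed_vector \<Rightarrow> 'a \<Rightarrow>\<^sub>L real) \<Rightarrow> 'a set \<Rightarrow> 'a \<Rightarrow> 'a \<Rightarrow> real \<Rightarrow> bool"
where
  "strongly_p_regular p f C x0 h \<epsilon> \<longleftrightarrow>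
    (\<exists>c>0. \<forall>y1 y2. \<forall>t\<in>{0<..<\<epsilon>}.
      hausdorff_distance (set_inverse (L_map p f C x0 (t *\<^sub>R h)) y1)
                         (set_inverse (L_map p f C x0 (t *\<^sub>R h)) y2)
        \<le> ennreal (c / t ^ (p - 1) * norm (y1 - y2)))"

definition tangent_cone :: "'a::real_normed_vector set \<Rightarrow> 'a \<Rightarrow> 'a set" where
  "tangent_cone M x0 =
    {h. \<exists>\<epsilon>>0. \<exists>w::'a \<Rightarrow> 'a.
          (\<forall>t\<in>{0..<\<epsilon>}. x0 + t *\<^sub>R h + w (t *\<^sub>R h) \<in> M) \<and>
          (\<lambda>t. norm (w (t *\<^sub>R h))) \<in> o[at_right 0](\<lambda>t. t)}"


section \<open>Two remarks on the hypotheses\<close>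

text \<open>
  The factor \<open>1 / (p - 1)!\<close> in \<open>L_map\<close> is irrelevant for the inclusion \<open>0 \<in> L\<^sub>h(0)\<close>, because
  the values of the normal cone map are cones.
\<close>

lemma normal_cone_scaleR: "z \<in> normal_cone C x \<Longrightarrow> 0 \<le> a \<Longrightarrow> a *\<^sub>R z \<in> normal_cone C x"
  by (auto simp: normal_cone_def blinfun.scaleR_left mult_nonneg_nonpos split: if_splits)

lemma zero_in_translate_iff: "0 \<in> (\<lambda>z. a + z) ` N \<longleftrightarrow> - a \<in> N" for a :: "'a::group_add"
  by (auto simp: image_iff minus_unique intro: bexI[of _ "- a"])

lemma zero_in_L_map_iff:
  "0 \<in> L_map p f C x0 h 0 \<longleftrightarrow>
    0 \<in> (\<lambda>z. fderiv p f x0 (replicate (p - 1) h @ [h]) + z) ` normal_cone C (x0 + h)"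
proof -
  let ?a = "fderiv p f x0 (replicate (p - 1) h @ [h])"
  let ?N = "normal_cone C (x0 + h)"
  have "- ?a \<in> ?N" if "- ((1 / fact (p - 1)) *\<^sub>R ?a) \<in> ?N"
    using normal_cone_scaleR[OF that, of "fact (p - 1)"] by simp
  moreover have "- ((1 / fact (p - 1)) *\<^sub>R ?a) \<in> ?N" if "- ?a \<in> ?N"
    using normal_cone_scaleR[OF that, of "1 / fact (p - 1)"] by simp
  ultimately show ?thesis
    by (auto simp: L_map_def zero_in_translate_iff)
qed

text \<open>
  Tangent vectors \<open>h\<close> of the solution set satisfy \<open>\<langle>f(x\<^sub>0), h\<rangle> = 0\<close>. This is trivial if
  \<open>f(x\<^sub>0) = 0\<close>, but in general it does not follow from \<open>0 \<in> f(x\<^sub>0) + N\<^sub>C(x\<^sub>0)\<close>, complete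
  degeneracy, \<open>0 \<in> L\<^bsub>th\<^esub>(0)\<close> and strong \<open>p\<close>-regularity along \<open>h\<close>, and therefore has to be a
  hypothesis of its own in a sufficient condition for tangency. For example, let \<open>H\<close> be an
  infinite-dimensional Hilbert space, \<open>X = H \<times> \<real>\<close>, \<open>C = H \<times> [0, \<infinity>)\<close>, \<open>p = 2\<close>,
  \<open>x\<^sub>0 = 0\<close>, \<open>h = (0, 1)\<close>, let \<open>A : H \<rightarrow> X\<^sup>*\<close> be an isomorphism, \<open>n(u, s) = s\<close> and
  \<open>f(u, s) = n + s A u\<close>. Then \<open>L\<^bsub>th\<^esub>(u, s) = t A u + N\<^sub>C(u, t + s)\<close>, where \<open>N\<^sub>C(u, t + s)\<close> does
  not depend on \<open>u\<close>, so the inverse is Lipschitz with constant \<open>\<parallel>A\<inverse>\<parallel> / t\<close>; but near \<open>0\<close> all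
  solutions lie in \<open>H \<times> {0}\<close>.
\<close>

lemma tangent_cone_solution_set_orthogonal:
  fixes f :: "'a::real_normed_vector \<Rightarrow> 'a \<Rightarrow>\<^sub>L real"
  assumes cont: "isCont f x0" and x0: "0 \<in> gen_map f C x0"
    and h: "h \<in> tangent_cone (solution_set (gen_map f C)) x0"
  shows "blinfun_apply (f x0) h = 0"
proof -
  obtain e w where e: "e > 0"
    and sol: "\<And>t. 0 \<le> t \<Longrightarrow> t < e \<Longrightarrow> 0 \<in> gen_map f C (x0 + t *\<^sub>R h + w (t *\<^sub>R h))"
    and o: "(\<lambda>t. norm (w (t *\<^sub>R h))) \<in> o[at_right 0](\<lambda>t. t)"
    using h unfolding tangent_cone_def solution_set_def mem_Collect_eq
    by (metis atLeastLessThan_iff)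
  define q where "q t = (1 / t) *\<^sub>R w (t *\<^sub>R h)" for t
  define z where "z t = x0 + t *\<^sub>R h + w (t *\<^sub>R h)" for t
  have pos: "\<forall>\<^sub>F t::real in at_right 0. t > 0"
    by (simp add: eventually_at_right_less)
  have le: "\<forall>\<^sub>F t in at_right 0. t < e"
    using e by (auto simp: eventually_at_right_field)
  have "((\<lambda>t. norm (w (t *\<^sub>R h)) / t) \<longlongrightarrow> 0) (at_right 0)"
    by (rule smalloD_tendsto[OF o])
  moreover have "\<forall>\<^sub>F t in at_right 0. norm (w (t *\<^sub>R h)) / t = norm (q t)"
    using pos by eventually_elim (simp add: q_def)
  ultimately have "((\<lambda>t. norm (q t)) \<longlongrightarrow> 0) (at_right 0)"
    by (rule Lim_transform_eventually)
  then have q0: "(q \<longlongrightarrow> 0) (at_right 0)"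
    by (rule tendsto_norm_zero_cancel)
  have id0: "((\<lambda>t::real. t) \<longlongrightarrow> 0) (at_right 0)"
    by (rule tendsto_ident_at)
  have "((\<lambda>t. x0 + t *\<^sub>R (h + q t)) \<longlongrightarrow> x0 + 0 *\<^sub>R (h + 0)) (at_right 0)"
    by (intro tendsto_intros q0 id0)
  moreover have z_eq: "\<forall>\<^sub>F t in at_right 0. x0 + t *\<^sub>R (h + q t) = z t"
    using pos by eventually_elim (simp add: q_def z_def algebra_simps)
  ultimately have "(z \<longlongrightarrow> x0) (at_right 0)"
    using Lim_transform_eventually by fastforce
  then have fz: "((\<lambda>t. f (z t)) \<longlongrightarrow> f x0) (at_right 0)"
    using cont isCont_tendsto_compose by blast
  have x0C: "x0 \<in> C" and n0: "\<And>c. c \<in> C \<Longrightarrow> 0 \<le> blinfun_apply (f x0) (c - x0)"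
    using x0 by (auto simp: gen_map_def zero_in_translate_iff normal_cone_def blinfun.minus_left
        split: if_splits)
  have zC: "z t \<in> C" "\<And>c. c \<in> C \<Longrightarrow> 0 \<le> blinfun_apply (f (z t)) (c - z t)"
    if "0 < t" "t < e" for t
    using sol[of t] that
    by (auto simp: gen_map_def zero_in_translate_iff normal_cone_def blinfun.minus_left z_def
        split: if_splits)
  have "((\<lambda>t. blinfun_apply (f x0) (h + q t)) \<longlongrightarrow> blinfun_apply (f x0) (h + 0)) (at_right 0)"
    by (intro tendsto_intros q0)
  moreover have "\<forall>\<^sub>F t in at_right 0. 0 \<le> blinfun_apply (f x0) (h + q t)"
    using pos le z_eq
  proof eventually_elim
    case (elim t)
    have "0 \<le> blinfun_apply (f x0) (z t - x0)" using n0 zC elim by blast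
    also have "z t - x0 = t *\<^sub>R (h + q t)" using elim by (metis add_diff_cancel_left')
    finally show ?case using elim by (simp add: blinfun.scaleR_right zero_le_mult_iff)
  qed
  ultimately have "0 \<le> blinfun_apply (f x0) (h + 0)"
    by (rule tendsto_lowerbound) simp
  moreover
  have "((\<lambda>t. blinfun_apply (f (z t)) (h + q t)) \<longlongrightarrow> blinfun_apply (f x0) (h + 0)) (at_right 0)"
    by (intro tendsto_intros q0 fz)
  moreover have "\<forall>\<^sub>F t in at_right 0. blinfun_apply (f (z t)) (h + q t) \<le> 0"
    using pos le z_eq
  proof eventually_elim
    case (elim t)
    have "0 \<le> blinfun_apply (f (z t)) (x0 - z t)" using x0C zC elim by blast
    also have "x0 - z t = - (t *\<^sub>R (h + q t))" using elim by (metis add_diff_cancel_left' minus_diff_eq)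
    finally show ?case
      using elim by (simp add: blinfun.minus_right blinfun.scaleR_right mult_le_0_iff)
  qed
  then have "blinfun_apply (f x0) (h + 0) \<le> 0"
    using tendsto_upperbound calculation(2) trivial_limit_at_right_real by blast
  ultimately show ?thesis by simp
qed

end

theory Submission
  imports Defs
begin

text \<open>
  Put \<open>a = th\<close>, \<open>A(v) = f\<^sup>(\<^sup>p\<^sup>)(x\<^sub>0)[a]\<^bsup>p-1\<^esup>[v] / (p-1)!\<close> and
  \<open>G(w) = A(a + w) - f(x\<^sub>0 + a + w)\<close>. Then \<open>x\<^sub>0 + a + w\<close> is a solution iff
  \<open>w \<in> L\<^sub>a\<inverse>(G(w))\<close>. By degeneracy, \<open>G\<close> is Lipschitz with constant \<open>O(t\<^sup>p)\<close> on a ball of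
  radius \<open>O(t\<^sup>2)\<close>, while \<open>L\<^sub>a\<inverse>\<close> is Lipschitz with constant \<open>c / t\<^bsup>p-1\<^esup>\<close>, so \<open>w \<mapsto> L\<^sub>a\<inverse>(G(w))\<close>
  is a set-valued contraction for small \<open>t\<close>.
  Since \<open>- f(x\<^sub>0)\<close> annihilates \<open>h\<close>, it lies in \<open>N\<^sub>C(x\<^sub>0 + a)\<close> as well, and as this is a
  convex cone, \<open>0 \<in> L\<^sub>a\<inverse>(y)\<close> for \<open>y = A(a) - f\<^sup>(\<^sup>p\<^sup>)(x\<^sub>0)[a]\<^sup>p / p! - f(x\<^sub>0)\<close>. Taylor's theorem
  gives \<open>\<parallel>G(0) - y\<parallel> = O(t\<^bsup>p+1\<^esup>)\<close>, hence the iteration starts with a step of length \<open>O(t\<^sup>2)\<close> and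
  has a fixed point \<open>w\<close> of norm \<open>O(t\<^sup>2)\<close>.
\<close>

section \<open>Set-valued contractions\<close>

lemma summable_increments_convergent:
  fixes x :: "nat \<Rightarrow> 'a::banach"
  assumes "summable (\<lambda>k. norm (x (Suc k) - x k))"
  shows "convergent x"
proof -
  have "summable (\<lambda>k. x (Suc k) - x k)"
    using assms by (rule summable_norm_cancel)
  then have "convergent (\<lambda>k. \<Sum>i<k. x (Suc i) - x i)"
    by (simp add: summable_iff_convergent)
  then have "convergent (\<lambda>k. x k - x 0)"
    by (simp add: sum_lessThan_telescope)
  then have "convergent (\<lambda>k. (x k - x 0) + x 0)"
    by (intro convergent_add convergent_const)
  then show ?thesis by simp
qed

text \<open>Repeated use of \<open>step\<close> gives iterates whose increments are dominated by a
  geometric series, so they stay in the ball and converge. The sequence and its shift have the same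
  limit \<open>u\<close>, which is exactly the situation of \<open>closed_graph\<close>.\<close>

lemma set_valued_contraction_fixpoint:
  fixes \<Phi> :: "'a::banach \<Rightarrow> 'a set"
  assumes q: "0 \<le> q" "q < 1"
    and start: "x1 \<in> \<Phi> x0" "norm (x1 - x0) \<le> (1 - q) * r"
    and step: "\<And>x x' y. x \<in> cball x0 r \<Longrightarrow> x' \<in> cball x0 r \<Longrightarrow> y \<in> \<Phi> x \<Longrightarrow>
      \<exists>y'\<in>\<Phi> x'. norm (y' - y) \<le> q * norm (x' - x)"
    and closed_graph: "\<And>x y u. (\<And>k. x k \<in> cball x0 r) \<Longrightarrow> (\<And>k. y k \<in> \<Phi> (x k)) \<Longrightarrow>
      x \<longlonglongrightarrow> u \<Longrightarrow> y \<longlonglongrightarrow> u \<Longrightarrow> u \<in> \<Phi> u"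
  shows "\<exists>u\<in>cball x0 r. u \<in> \<Phi> u"
proof -
  \<comment> \<open>\<open>z\<close> is a pair of consecutive iterates, since the size of the next
    increment depends on the last one. The bound \<open>(1 - q ^ k) * r\<close> is the sum of the
    increments \<open>q ^ i * (1 - q) * r\<close> over \<open>i < k\<close>.\<close>
  define P where "P k z \<longleftrightarrow> snd z \<in> \<Phi> (fst z) \<and> norm (fst z - x0) \<le> (1 - q ^ k) * r \<and>
    norm (snd z - fst z) \<le> q ^ k * (1 - q) * r" for k :: nat and z :: "'a \<times> 'a"
  have r: "0 \<le> r"
  proof -
    have "0 \<le> (1 - q) * r" using start(2) norm_ge_zero order_trans by blast
    then show ?thesis using q by (simp add: zero_le_mult_iff)
  qed
  have in_ball: "z \<in> cball x0 r" if "norm (z - x0) \<le> (1 - q ^ k) * r" for z k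
  proof -
    have "(1 - q ^ k) * r \<le> 1 * r"
      using q r by (intro mult_right_mono) auto
    then show ?thesis using that by (simp add: dist_norm norm_minus_commute)
  qed
  have "\<exists>z. \<forall>k. P k (z k) \<and> fst (z (Suc k)) = snd (z k)"
  proof (rule dependent_nat_choice)
    show "\<exists>z. P 0 z" using start by (auto simp: P_def intro!: exI[of _ "(x0, x1)"])
  next
    fix z k assume z: "P k z"
    have nxt: "norm (snd z - x0) \<le> (1 - q ^ Suc k) * r"
    proof -
      have "norm (snd z - x0) \<le> norm (snd z - fst z) + norm (fst z - x0)"
        using norm_triangle_ineq[of "snd z - fst z" "fst z - x0"] by simp
      also have "\<dots> \<le> q ^ k * (1 - q) * r + (1 - q ^ k) * r"
        using z by (auto simp: P_def)
      finally show ?thesis by (simp add: algebra_simps)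
    qed
    have "fst z \<in> cball x0 r" "snd z \<in> cball x0 r" "snd z \<in> \<Phi> (fst z)"
      using in_ball[OF nxt] in_ball z by (auto simp: P_def)
    from step[OF this] obtain y where y: "y \<in> \<Phi> (snd z)"
      "norm (y - snd z) \<le> q * norm (snd z - fst z)" by blast
    have "q * norm (snd z - fst z) \<le> q * (q ^ k * (1 - q) * r)"
      using z q by (intro mult_left_mono) (auto simp: P_def)
    then have "P (Suc k) (snd z, y)"
      using y nxt by (simp add: P_def mult.assoc)
    then show "\<exists>z'. P (Suc k) z' \<and> fst z' = snd z" by (intro exI[of _ "(snd z, y)"]) simp
  qed
  then obtain z where z: "\<And>k. P k (z k)" and zS: "\<And>k. fst (z (Suc k)) = snd (z k)" by blast
  define x where "x k = fst (z k)" for k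
  have "summable (\<lambda>k. norm (x (Suc k) - x k))"
  proof (rule summable_comparison_test')
    show "summable (\<lambda>k. q ^ k * ((1 - q) * r))"
      using q by (intro summable_mult2 summable_geometric) simp
    show "norm (norm (x (Suc k) - x k)) \<le> q ^ k * ((1 - q) * r)" for k
      using z[of k] by (simp add: P_def x_def zS mult.assoc)
  qed
  then obtain u where u: "x \<longlonglongrightarrow> u"
    using summable_increments_convergent convergent_def by blast
  have xb: "x k \<in> cball x0 r" for k
    using in_ball z[of k] by (auto simp: P_def x_def)
  have "u \<in> \<Phi> u"
  proof (rule closed_graph[OF xb _ u])
    show "x (Suc k) \<in> \<Phi> (x k)" for k using z[of k] by (simp add: P_def x_def zS)
    show "(\<lambda>k. x (Suc k)) \<longlonglongrightarrow> u" using u by (rule LIMSEQ_Suc)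
  qed
  moreover have "u \<in> cball x0 r"
    using closed_cball xb u by (rule closed_sequentially)
  ultimately show ?thesis by blast
qed

text \<open>The infimum over \<open>S2\<close> need not be attained, hence the strictly larger
  \<open>b'\<close>. For empty \<open>S2\<close> it would be infinite, so the finite bound also
  yields a point of \<open>S2\<close>.\<close>

lemma hausdorff_distance_obtain:
  assumes "hausdorff_distance S1 S2 \<le> ennreal b" and "x \<in> S1" and "b < b'" and "0 \<le> b"
  obtains y where "y \<in> S2" "dist x y < b'"
proof -
  have "(INF y\<in>S2. ennreal (dist x y)) \<le> (SUP x\<in>S1. INF y\<in>S2. ennreal (dist x y))"
    using assms(2) by (rule SUP_upper)
  also have "\<dots> \<le> ennreal b"
    using assms(1) by (simp add: hausdorff_distance_def)
  also have "\<dots> < ennreal b'"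
    using assms(3,4) by (simp add: ennreal_less_iff)
  finally obtain y where "y \<in> S2" "ennreal (dist x y) < ennreal b'"
    by (auto simp: INF_less_iff)
  then show ?thesis using that by (simp add: ennreal_less_iff)
qed


section \<open>Normal cones\<close>

lemma normal_cone_add:
  "y \<in> normal_cone C x \<Longrightarrow> z \<in> normal_cone C x \<Longrightarrow> y + z \<in> normal_cone C x"
  by (auto simp: normal_cone_def blinfun.add_left add_nonpos_nonpos split: if_splits)

text \<open>If \<open>z\<close> vanishes on \<open>x' - x\<close>, it takes the same value on
  \<open>c - x\<close> and on \<open>c - x'\<close>. This carries \<open>- f x0\<close> from
  \<open>x0\<close> to \<open>x0 + t *\<^sub>R h\<close>.\<close>

lemma normal_cone_move:
  assumes "z \<in> normal_cone C x" and "x' \<in> C" and "blinfun_apply z (x' - x) = 0"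
  shows "z \<in> normal_cone C x'"
  using assms by (auto simp: normal_cone_def blinfun.diff_right split: if_splits)

text \<open>Both sequences converge in norm and the pairing is jointly continuous, so the defining
  inequalities pass to the limit.\<close>

lemma normal_cone_closed_graph:
  assumes "closed C" and mem: "\<And>k. z k \<in> normal_cone C (x k)"
    and x: "x \<longlonglongrightarrow> u" and z: "z \<longlonglongrightarrow> v"
  shows "v \<in> normal_cone C u"
proof -
  have xC: "x k \<in> C" and le: "c \<in> C \<Longrightarrow> blinfun_apply (z k) (c - x k) \<le> 0" for k c
    using mem[of k] by (auto simp: normal_cone_def split: if_splits)
  have "u \<in> C" using assms(1) xC x by (rule closed_sequentially)
  moreover have "blinfun_apply v (c - u) \<le> 0" if "c \<in> C" for c
  proof (rule LIMSEQ_le_const2)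
    show "(\<lambda>k. blinfun_apply (z k) (c - x k)) \<longlonglongrightarrow> blinfun_apply v (c - u)"
      by (intro tendsto_intros x z)
  qed (use le that in blast)
  ultimately show ?thesis by (simp add: normal_cone_def)
qed


section \<open>Multilinear maps and Taylor expansion\<close>

lemma bounded_multilinear_boundE:
  assumes "bounded_multilinear k m"
  obtains K where "K > 0" "\<And>hs. length hs = k \<Longrightarrow> norm (m hs) \<le> K * (\<Prod>h\<leftarrow>hs. norm h)"
proof -
  obtain K where K: "length hs = k \<Longrightarrow> norm (m hs) \<le> K * (\<Prod>h\<leftarrow>hs. norm h)" for hs
    using assms unfolding bounded_multilinear_def by blast
  have "norm (m hs) \<le> (\<bar>K\<bar> + 1) * (\<Prod>h\<leftarrow>hs. norm h)" if "length hs = k" for hs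
  proof -
    have "0 \<le> (\<Prod>h\<leftarrow>hs. norm h)" by (rule prod_list_nonneg) auto
    then have "K * (\<Prod>h\<leftarrow>hs. norm h) \<le> (\<bar>K\<bar> + 1) * (\<Prod>h\<leftarrow>hs. norm h)"
      by (intro mult_right_mono) auto
    then show ?thesis using K[OF that] by linarith
  qed
  then show ?thesis using that[of "\<bar>K\<bar> + 1"] by simp
qed

lemma bounded_multilinear_linear_middle:
  assumes "bounded_multilinear k m" and "length as + Suc (length bs) = k"
  shows "linear (\<lambda>v. m (as @ v # bs))"
proof -
  have *: "length (as @ 0 # bs) = k \<and> length as < k"
    using assms(2) by simp
  have "linear (\<lambda>v. m ((as @ 0 # bs)[length as := v]))"
    using assms(1) * unfolding bounded_multilinear_def by blast
  then show ?thesis by simp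
qed

lemma bounded_multilinear_bounded_linear_middle:
  assumes "bounded_multilinear k m" and "length as + Suc (length bs) = k"
  shows "bounded_linear (\<lambda>v. m (as @ v # bs))"
proof -
  obtain K where K: "length hs = k \<Longrightarrow> norm (m hs) \<le> K * (\<Prod>h\<leftarrow>hs. norm h)" for hs
    using bounded_multilinear_boundE[OF assms(1)] by blast
  show ?thesis
    unfolding bounded_linear_def bounded_linear_axioms_def
  proof (intro conjI exI allI)
    show "linear (\<lambda>v. m (as @ v # bs))" using assms by (rule bounded_multilinear_linear_middle)
    show "norm (m (as @ v # bs)) \<le> norm v * (K * (\<Prod>h\<leftarrow>as @ bs. norm h))" for v
      using K[of "as @ v # bs"] assms(2) by (simp add: mult_ac)
  qed
qed

text \<open>The copies of \<open>u\<close> are exchanged for \<open>a\<close> one at a time from the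
  left, and each exchange produces one argument \<open>u - a\<close>. The prefix \<open>as\<close>
  is arbitrary in the induction because it collects the copies of \<open>a\<close> already in
  place.\<close>

lemma multilinear_replicate_diff_bound:
  assumes m: "bounded_multilinear k m" and K: "K \<ge> 0"
    "\<And>hs. length hs = k \<Longrightarrow> norm (m hs) \<le> K * (\<Prod>h\<leftarrow>hs. norm h)"
    and len: "length as + n + length bs = k"
    and R: "norm u \<le> R" "norm a \<le> R"
  shows "norm (m (as @ replicate n u @ bs) - m (as @ replicate n a @ bs))
    \<le> K * (\<Prod>h\<leftarrow>as. norm h) * (real n * R ^ (n - 1) * norm (u - a)) * (\<Prod>h\<leftarrow>bs. norm h)"
  using len
proof (induction n arbitrary: as)
  case (Suc n)
  let ?A = "\<Prod>h\<leftarrow>as. norm h" and ?B = "\<Prod>h\<leftarrow>bs. norm h"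
  have nn: "0 \<le> ?A" "0 \<le> ?B" by (auto intro!: prod_list_nonneg)
  have R0: "0 \<le> R" using R(1) norm_ge_zero order_trans by blast
  have "m (as @ (u - a) # replicate n u @ bs)
      = m (as @ u # replicate n u @ bs) - m (as @ a # replicate n u @ bs)"
    using linear_diff[OF bounded_multilinear_linear_middle[OF m]] Suc.prems by simp
  then have eq: "m (as @ replicate (Suc n) u @ bs) - m (as @ replicate (Suc n) a @ bs)
      = m (as @ (u - a) # replicate n u @ bs)
        + (m ((as @ [a]) @ replicate n u @ bs) - m ((as @ [a]) @ replicate n a @ bs))"
    by simp
  have "norm (m (as @ (u - a) # replicate n u @ bs)) \<le> K * (?A * (norm (u - a) * (norm u ^ n * ?B)))"
    using K(2)[of "as @ (u - a) # replicate n u @ bs"] Suc.prems by (simp add: prod_list_replicate)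
  also have "\<dots> \<le> K * (?A * (norm (u - a) * (R ^ n * ?B)))"
    using K(1) nn R R0 by (intro mult_left_mono mult_right_mono power_mono mult_nonneg_nonneg) auto
  finally have 1: "norm (m (as @ (u - a) # replicate n u @ bs)) \<le> K * (?A * (norm (u - a) * (R ^ n * ?B)))" .
  have "norm (m ((as @ [a]) @ replicate n u @ bs) - m ((as @ [a]) @ replicate n a @ bs))
      \<le> K * (\<Prod>h\<leftarrow>as @ [a]. norm h) * (real n * R ^ (n - 1) * norm (u - a)) * ?B"
    using Suc.prems by (intro Suc.IH) simp
  also have "\<dots> = K * (?A * norm a) * (real n * R ^ (n - 1) * norm (u - a)) * ?B"
    by simp
  also have "\<dots> \<le> K * (?A * R) * (real n * R ^ (n - 1) * norm (u - a)) * ?B"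
    using K(1) nn R R0 by (intro mult_left_mono mult_right_mono mult_nonneg_nonneg) auto
  \<comment> \<open>For \<open>n = 0\<close> the truncated exponent breaks
    \<open>R * R ^ (n - 1) = R ^ n\<close>, but then the factor \<open>real n\<close> is
    zero.\<close>
  also have "\<dots> = K * ?A * (real n * R ^ n * norm (u - a)) * ?B"
    by (cases n) simp_all
  finally have 2: "norm (m ((as @ [a]) @ replicate n u @ bs) - m ((as @ [a]) @ replicate n a @ bs))
      \<le> K * ?A * (real n * R ^ n * norm (u - a)) * ?B" .
  show ?case
    unfolding eq using norm_triangle_le[OF add_mono[OF 1 2]] by (simp add: algebra_simps)
qed simp

section \<open>Derivatives of maps of class \<open>C_diff\<close>\<close>

lemma C_diff_bounded_multilinear:
  "C_diff n f \<Longrightarrow> k \<le> n \<Longrightarrow> bounded_multilinear k (fderiv k f x)"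
  by (simp add: C_diff_def)

lemma C_diff_has_derivative:
  fixes f :: "'a::real_normed_vector \<Rightarrow> 'b::real_normed_vector"
  assumes C: "C_diff n f" and k: "k < n" and len: "length hs = k"
  shows "((\<lambda>y. fderiv k f y hs) has_derivative (\<lambda>v. fderiv (Suc k) f x (v # hs))) (at x)"
proof -
  have bl: "bounded_linear (\<lambda>v. fderiv (Suc k) f x (v # hs))"
    using bounded_multilinear_bounded_linear_middle[OF C_diff_bounded_multilinear[OF C], of "Suc k" "[]" hs x] k len
    by simp
  define S where "S = (\<Prod>h\<leftarrow>hs. norm h)"
  have S: "0 \<le> S" unfolding S_def by (rule prod_list_nonneg) auto
  show ?thesis
    unfolding has_derivative_within_alt2
  proof (intro conjI bl allI impI)
    fix e :: real assume "e > 0"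
    \<comment> \<open>The estimate uniform in \<open>hs\<close> carries the factor \<open>S\<close>;
      dividing by \<open>S + 1\<close> absorbs it even when some direction is zero and
      \<open>S = 0\<close>.\<close>
    then have e': "e / (S + 1) > 0" using S by simp
    have "\<forall>\<^sub>F y in at x. \<forall>hs. length hs = k \<longrightarrow>
        norm (fderiv k f y hs - fderiv k f x hs - fderiv (Suc k) f x ((y - x) # hs))
          \<le> (e / (S + 1)) * norm (y - x) * (\<Prod>h\<leftarrow>hs. norm h)"
      using C k e' unfolding C_diff_def by blast
    then show "\<forall>\<^sub>F y in at x. norm (fderiv k f y hs - fderiv k f x hs - fderiv (Suc k) f x ((y - x) # hs))
        \<le> e * norm (y - x)"
    proof eventually_elim
      case (elim y)
      have "(e / (S + 1)) * norm (y - x) * S = e * norm (y - x) * (S / (S + 1))"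
        by simp
      also have "\<dots> \<le> e * norm (y - x) * 1"
        using S \<open>e > 0\<close> by (intro mult_left_mono) auto
      finally show ?case using elim len by (force simp: S_def)
    qed
  qed
qed

text \<open>The first order expansion at \<open>x\<close> with error factor 1, together with a bound
  \<open>K\<close> on the next derivative at \<open>x\<close>, gives the constant
  \<open>K + 1\<close>. Used with \<open>k = p\<close>, this is where the derivative of order
  \<open>p + 1\<close> enters.\<close>

lemma C_diff_locally_Lipschitz:
  assumes C: "C_diff (Suc k) f"
  obtains K d where "K > 0" "d > 0"
    "\<And>u hs. norm u < d \<Longrightarrow> length hs = k \<Longrightarrow>
      norm (fderiv k f (x + u) hs - fderiv k f x hs) \<le> K * norm u * (\<Prod>h\<leftarrow>hs. norm h)"
proof -
  obtain K where K: "K > 0"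
    "\<And>hs. length hs = Suc k \<Longrightarrow> norm (fderiv (Suc k) f x hs) \<le> K * (\<Prod>h\<leftarrow>hs. norm h)"
    using bounded_multilinear_boundE[OF C_diff_bounded_multilinear[OF C order_refl]] by blast
  have "\<forall>\<^sub>F y in at x. \<forall>hs. length hs = k \<longrightarrow>
        norm (fderiv k f y hs - fderiv k f x hs - fderiv (Suc k) f x ((y - x) # hs))
          \<le> 1 * norm (y - x) * (\<Prod>h\<leftarrow>hs. norm h)"
    using C unfolding C_diff_def by (meson lessI zero_less_one)
  then obtain d where d: "d > 0"
    "\<And>y hs. y \<noteq> x \<Longrightarrow> dist y x < d \<Longrightarrow> length hs = k \<Longrightarrow>
        norm (fderiv k f y hs - fderiv k f x hs - fderiv (Suc k) f x ((y - x) # hs))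
          \<le> norm (y - x) * (\<Prod>h\<leftarrow>hs. norm h)"
    unfolding eventually_at by auto
  have "norm (fderiv k f (x + u) hs - fderiv k f x hs) \<le> (K + 1) * norm u * (\<Prod>h\<leftarrow>hs. norm h)"
    if "norm u < d" "length hs = k" for u hs
  proof (cases "u = 0")
    case False
    have "norm (fderiv k f (x + u) hs - fderiv k f x hs - fderiv (Suc k) f x (u # hs))
        \<le> norm u * (\<Prod>h\<leftarrow>hs. norm h)"
      using d(2)[of "x + u" hs] that False by (simp add: dist_norm)
    moreover have "norm (fderiv (Suc k) f x (u # hs)) \<le> K * norm u * (\<Prod>h\<leftarrow>hs. norm h)"
      using K(2)[of "u # hs"] that by (simp add: mult.assoc)
    moreover have "norm (fderiv k f (x + u) hs - fderiv k f x hs)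
        \<le> norm (fderiv k f (x + u) hs - fderiv k f x hs - fderiv (Suc k) f x (u # hs))
          + norm (fderiv (Suc k) f x (u # hs))"
      using norm_triangle_ineq by (metis diff_add_cancel)
    ultimately show ?thesis by (simp add: algebra_simps)
  qed simp
  then show ?thesis using that[of "K + 1" d] K d by simp
qed

text \<open>\<open>g k\<close> stands for the derivative of order \<open>k\<close> of
  \<open>g 0\<close>. As the intermediate ones vanish at 0, only the constant and the leading term
  of the Taylor polynomial remain. The induction integrates the bound for the shifted family by the
  mean value inequality; \<open>B\<close> survives unchanged because the interval has length
  1.\<close>

lemma degenerate_Taylor_bound:
  fixes g :: "nat \<Rightarrow> real \<Rightarrow> 'b::real_normed_vector"
  assumes "m \<ge> 1"
    and "\<And>k s. k < m \<Longrightarrow> s \<in> {0..1} \<Longrightarrow> (g k has_vector_derivative g (Suc k) s) (at s within {0..1})"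
    and "\<And>k. 0 < k \<Longrightarrow> k < m \<Longrightarrow> g k 0 = 0"
    and "\<And>s. s \<in> {0..1} \<Longrightarrow> norm (g m s - g m 0) \<le> B"
    and "s \<in> {0..1}"
  shows "norm (g 0 s - g 0 0 - (s ^ m / fact m) *\<^sub>R g m 0) \<le> B"
  using assms
proof (induction m arbitrary: g s)
  case (Suc m)
  \<comment> \<open>This bounds the derivative of the function \<open>\<phi>\<close> below. The case
    \<open>m = 0\<close> is separate: there \<open>g 1\<close> is itself the top derivative and need
    not vanish at 0.\<close>
  have g1: "norm (g 1 s - (s ^ m / fact m) *\<^sub>R g (Suc m) 0) \<le> B" if "s \<in> {0..1}" for s
  proof (cases "m = 0")
    case True
    then show ?thesis using Suc.prems(4)[OF that] by simp
  next
    case False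
    have "norm (g (Suc 0) s - g (Suc 0) 0 - (s ^ m / fact m) *\<^sub>R g (Suc m) 0) \<le> B"
      using False that by (intro Suc.IH[of "\<lambda>k. g (Suc k)"] Suc.prems) auto
    then show ?thesis using False Suc.prems(3)[of 1] by simp
  qed
  define \<phi> where "\<phi> s = g 0 s - (s ^ Suc m / fact (Suc m)) *\<^sub>R g (Suc m) 0" for s
  have "norm (\<phi> s - \<phi> 0) \<le> B * norm (s - 0)"
  proof (rule differentiable_bound)
    show "convex {0..1::real}" by simp
    fix x :: real assume x: "x \<in> {0..1}"
    have eq: "real (Suc m) * x ^ m / fact (Suc m) = x ^ m / fact m"
      by (simp add: field_simps del: of_nat_Suc)
    have "((\<lambda>s. s ^ Suc m / fact (Suc m)) has_real_derivative real (Suc m) * x ^ m / fact (Suc m)) (at x within {0..1})"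
      using DERIV_cdivide[OF DERIV_pow[of "Suc m" x "{0..1}"], of "fact (Suc m)"] by simp
    from has_vector_derivative_scaleR[OF this has_vector_derivative_const[of "g (Suc m) 0"]]
    have "(\<phi> has_vector_derivative g 1 x - (x ^ m / fact m) *\<^sub>R g (Suc m) 0) (at x within {0..1})"
      unfolding \<phi>_def eq using has_vector_derivative_diff[OF Suc.prems(2)[OF _ x, of 0]] by simp
    then show "(\<phi> has_derivative (\<lambda>y. y *\<^sub>R (g 1 x - (x ^ m / fact m) *\<^sub>R g (Suc m) 0))) (at x within {0..1})"
      by (simp add: has_vector_derivative_def)
    show "onorm (\<lambda>y. y *\<^sub>R (g 1 x - (x ^ m / fact m) *\<^sub>R g (Suc m) 0)) \<le> B"
    proof (rule onorm_bound)
      show "0 \<le> B" using Suc.prems(4)[of 0] by simp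
      show "norm (y *\<^sub>R (g 1 x - (x ^ m / fact m) *\<^sub>R g (Suc m) 0)) \<le> B * norm y" for y
        using mult_left_mono[OF g1[OF x], of "\<bar>y\<bar>"] by (simp add: mult.commute)
    qed
  qed (use Suc.prems in auto)
  also have "\<dots> \<le> B * 1"
    using Suc.prems(4)[of 0] Suc.prems(5) by (intro mult_left_mono) auto
  finally show ?case by (simp add: \<phi>_def algebra_simps)
qed simp

text \<open>
  The directions \<open>vs\<close> are differentiated first and the increment \<open>u\<close> afterwards, so expanding
  along the segment produces \<open>fderiv\<close> with its arguments in the right order and no symmetry of
  higher derivatives is needed.
\<close>

lemma C_diff_degenerate_Taylor:
  fixes f :: "'a::real_normed_vector \<Rightarrow> 'b::real_normed_vector"
  assumes C: "C_diff (Suc p) f" and deg: "completely_degenerate p f x" and q: "length vs < p"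
    and K: "K \<ge> 0" "\<And>u hs. norm u < d \<Longrightarrow> length hs = p \<Longrightarrow>
      norm (fderiv p f (x + u) hs - fderiv p f x hs) \<le> K * norm u * (\<Prod>h\<leftarrow>hs. norm h)"
    and u: "norm u < d"
  shows "norm (fderiv (length vs) f (x + u) vs - fderiv (length vs) f x vs
      - (1 / fact (p - length vs)) *\<^sub>R fderiv p f x (replicate (p - length vs) u @ vs))
    \<le> K * norm u ^ Suc (p - length vs) * (\<Prod>h\<leftarrow>vs. norm h)"
proof -
  define m where "m = p - length vs"
  \<comment> \<open>Each differentiation along the segment puts one more \<open>u\<close> at the
    head of the list. For \<open>0 < k < m\<close> the order \<open>k + length vs\<close> lies
    between 1 and \<open>p - 1\<close>, so degeneracy makes \<open>g k 0\<close> vanish.\<close>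
  define g where "g k s = fderiv (k + length vs) f (x + s *\<^sub>R u) (replicate k u @ vs)" for k s
  have m: "m \<ge> 1" "m + length vs = p" using q by (auto simp: m_def)
  have V: "0 \<le> (\<Prod>h\<leftarrow>vs. norm h)" by (rule prod_list_nonneg) auto
  have "norm (g 0 1 - g 0 0 - (1 ^ m / fact m) *\<^sub>R g m 0)
      \<le> K * norm u ^ Suc m * (\<Prod>h\<leftarrow>vs. norm h)"
  proof (rule degenerate_Taylor_bound[OF m(1)])
    fix k and s :: real assume k: "k < m"
    have 1: "((\<lambda>y. fderiv (k + length vs) f y (replicate k u @ vs)) has_derivative
        (\<lambda>v. fderiv (Suc (k + length vs)) f (x + s *\<^sub>R u) (v # replicate k u @ vs))) (at (x + s *\<^sub>R u))"
      using k m by (intro C_diff_has_derivative[OF C]) auto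
    have "((\<lambda>s. x + s *\<^sub>R u) has_vector_derivative u) (at s within {0..1})"
      by (auto intro!: derivative_eq_intros)
    from has_derivative_compose[OF this[unfolded has_vector_derivative_def] 1]
    have 2: "(g k has_derivative
        (\<lambda>y. fderiv (Suc (k + length vs)) f (x + s *\<^sub>R u) (y *\<^sub>R u # replicate k u @ vs)))
        (at s within {0..1})" unfolding g_def[abs_def] .
    have "linear (\<lambda>v. fderiv (Suc (k + length vs)) f (x + s *\<^sub>R u) ([] @ v # replicate k u @ vs))"
      using k m by (intro bounded_multilinear_linear_middle[OF C_diff_bounded_multilinear[OF C]]) auto
    from linear_scale[OF this] 2
    show "(g k has_vector_derivative g (Suc k) s) (at s within {0..1})"
      by (simp add: has_vector_derivative_def g_def del: fderiv.simps)
  next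
    fix k assume "0 < k" "k < m"
    then have "k + length vs \<in> {1..p - 1}" using m by auto
    then show "g k 0 = 0"
      using deg by (simp add: completely_degenerate_def g_def)
  next
    fix s :: real assume s: "s \<in> {0..1}"
    have su: "norm (s *\<^sub>R u) \<le> norm u" using s by (simp add: mult_left_le_one_le)
    have "norm (g m s - g m 0) \<le> K * norm (s *\<^sub>R u) * (norm u ^ m * (\<Prod>h\<leftarrow>vs. norm h))"
      using K(2)[of "s *\<^sub>R u" "replicate m u @ vs"] su u m by (simp add: g_def prod_list_replicate)
    also have "\<dots> \<le> K * norm u * (norm u ^ m * (\<Prod>h\<leftarrow>vs. norm h))"
      using K(1) su V by (intro mult_right_mono mult_left_mono) auto
    finally show "norm (g m s - g m 0) \<le> K * norm u ^ Suc m * (\<Prod>h\<leftarrow>vs. norm h)"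
      by (simp add: mult_ac)
  qed simp
  then show ?thesis using m by (simp add: g_def flip: m_def)
qed


text \<open>Mean value inequality on the ball. The derivative at \<open>u\<close> is compared first
  with the leading Taylor term at \<open>a + u\<close> (error \<open>K * R ^ p\<close>, by the
  expansion with the single direction \<open>v\<close>), then that term with \<open>A\<close>, where
  \<open>a + u\<close> is replaced by \<open>a\<close> in \<open>p - 1\<close> arguments. With
  \<open>R\<close> of order t and \<open>r\<close> of order t^2 both errors are of order
  t^p.\<close>

lemma C_diff_linearization_bound:
  fixes f :: "'a::real_normed_vector \<Rightarrow> 'b::real_normed_vector" and a x :: 'a and p :: nat
  defines "A \<equiv> \<lambda>w. (1 / fact (p - 1)) *\<^sub>R fderiv p f x (replicate (p - 1) a @ [w])"
  assumes C: "C_diff (Suc p) f" and deg: "completely_degenerate p f x" and p: "p \<ge> 2"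
    and K: "K \<ge> 0" "\<And>u hs. norm u < d \<Longrightarrow> length hs = p \<Longrightarrow>
      norm (fderiv p f (x + u) hs - fderiv p f x hs) \<le> K * norm u * (\<Prod>h\<leftarrow>hs. norm h)"
    and M: "M \<ge> 0" "\<And>hs. length hs = p \<Longrightarrow> norm (fderiv p f x hs) \<le> M * (\<Prod>h\<leftarrow>hs. norm h)"
    and R: "norm a + r \<le> R" "R < d"
    and w: "w1 \<in> cball 0 r" "w2 \<in> cball 0 r"
  shows "norm ((f (x + a + w2) - A w2) - (f (x + a + w1) - A w1))
    \<le> (K * R ^ p + M * real (p - 1) * R ^ (p - 2) * r) * norm (w2 - w1)"
proof -
  have r: "0 \<le> r" using w(1) norm_ge_zero[of w1] by (simp del: norm_ge_zero)
  have aR: "norm a \<le> R" using R r by simp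
  have "bounded_linear (\<lambda>v. fderiv p f x (replicate (p - 1) a @ [v]))"
    using p by (intro bounded_multilinear_bounded_linear_middle[OF C_diff_bounded_multilinear[OF C]]) auto
  then have A: "bounded_linear A"
    unfolding A_def by (intro bounded_linear_intros)
  show ?thesis
  proof (rule differentiable_bound[OF convex_cball])
    fix u :: 'a assume u: "u \<in> cball 0 r"
    have uR: "norm (a + u) \<le> R" using norm_triangle_ineq[of a u] u R by simp
    have "((\<lambda>y. fderiv 0 f y []) has_derivative (\<lambda>v. fderiv (Suc 0) f (x + (a + u)) [v])) (at (x + (a + u)))"
      using C by (intro C_diff_has_derivative) auto
    then have 1: "(f has_derivative (\<lambda>v. fderiv 1 f (x + (a + u)) [v])) (at (x + a + u))"
      by (simp add: add.assoc del: fderiv.simps(2))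
    have "((\<lambda>w. x + a + w) has_derivative (\<lambda>v. v)) (at u within cball 0 r)"
      by (auto intro!: derivative_eq_intros)
    from has_derivative_compose[OF this 1]
    have "((\<lambda>w. f (x + a + w)) has_derivative (\<lambda>v. fderiv 1 f (x + (a + u)) [v])) (at u within cball 0 r)" .
    then show "((\<lambda>w. f (x + a + w) - A w) has_derivative (\<lambda>v. fderiv 1 f (x + (a + u)) [v] - A v))
        (at u within cball 0 r)"
      by (intro has_derivative_diff bounded_linear_imp_has_derivative[OF A])
    show "onorm (\<lambda>v. fderiv 1 f (x + (a + u)) [v] - A v)
        \<le> K * R ^ p + M * real (p - 1) * R ^ (p - 2) * r"
    proof (rule onorm_bound)
      have R0: "0 \<le> R" using aR norm_ge_zero order_trans by blast
      then show "0 \<le> K * R ^ p + M * real (p - 1) * R ^ (p - 2) * r"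
        using K(1) M(1) r by simp
      fix v :: 'a
      let ?D = "\<lambda>u. (1 / fact (p - 1)) *\<^sub>R fderiv p f x (replicate (p - 1) u @ [v])"
      have "norm (fderiv (length [v]) f (x + (a + u)) [v] - fderiv (length [v]) f x [v]
            - (1 / fact (p - length [v])) *\<^sub>R fderiv p f x (replicate (p - length [v]) (a + u) @ [v]))
          \<le> K * norm (a + u) ^ Suc (p - length [v]) * (\<Prod>h\<leftarrow>[v]. norm h)"
        using p uR R by (intro C_diff_degenerate_Taylor[OF C deg _ K]) auto
      moreover have "fderiv (length [v]) f x [v] = 0"
        using deg p by (simp add: completely_degenerate_def del: fderiv.simps)
      ultimately have "norm (fderiv 1 f (x + (a + u)) [v] - ?D (a + u)) \<le> K * norm (a + u) ^ p * norm v"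
        using p by (simp add: Suc_diff_Suc numeral_2_eq_2 del: fderiv.simps)
      also have "\<dots> \<le> K * R ^ p * norm v"
        using K(1) uR by (intro mult_right_mono mult_left_mono power_mono) auto
      finally have 1: "norm (fderiv 1 f (x + (a + u)) [v] - ?D (a + u)) \<le> K * R ^ p * norm v" .
      let ?\<Delta> = "fderiv p f x (replicate (p - 1) (a + u) @ [v]) - fderiv p f x (replicate (p - 1) a @ [v])"
      have "norm (fderiv p f x ([] @ replicate (p - 1) (a + u) @ [v])
            - fderiv p f x ([] @ replicate (p - 1) a @ [v]))
          \<le> M * (\<Prod>h\<leftarrow>([] :: 'a list). norm h) * (real (p - 1) * R ^ (p - 1 - 1) * norm (a + u - a)) * (\<Prod>h\<leftarrow>[v]. norm h)"
        using p by (intro multilinear_replicate_diff_bound[OF C_diff_bounded_multilinear[OF C] M _ uR aR]) auto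
      then have 2: "norm ?\<Delta> \<le> M * (real (p - 1) * R ^ (p - 2) * norm u) * norm v"
        by (simp add: numeral_2_eq_2)
      have "norm (?D (a + u) - A v) = (1 / fact (p - 1)) * norm ?\<Delta>"
        by (simp add: A_def flip: scaleR_diff_right)
      also have "\<dots> \<le> 1 * norm ?\<Delta>"
        by (intro mult_right_mono) (auto simp: fact_ge_1)
      also have "1 * norm ?\<Delta> \<le> M * (real (p - 1) * R ^ (p - 2) * norm u) * norm v"
        using 2 by simp
      also have "\<dots> \<le> M * (real (p - 1) * R ^ (p - 2) * r) * norm v"
        using M(1) R0 u by (intro mult_left_mono mult_right_mono) auto
      finally have 3: "norm (?D (a + u) - A v) \<le> M * (real (p - 1) * R ^ (p - 2) * r) * norm v" by simp
      have "norm ((fderiv 1 f (x + (a + u)) [v] - ?D (a + u)) + (?D (a + u) - A v))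
          \<le> K * R ^ p * norm v + M * (real (p - 1) * R ^ (p - 2) * r) * norm v"
        by (rule norm_triangle_le[OF add_mono[OF 1 3]])
      then show "norm (fderiv 1 f (x + (a + u)) [v] - A v)
          \<le> (K * R ^ p + M * real (p - 1) * R ^ (p - 2) * r) * norm v"
        by (simp add: algebra_simps del: fderiv.simps)
    qed
  qed (use w in auto)
qed


section \<open>Tangent directions\<close>

lemma L_map_iff:
  "y \<in> L_map p f C x0 h w \<longleftrightarrow>
    y - (1 / fact (p - 1)) *\<^sub>R fderiv p f x0 (replicate (p - 1) h @ [h + w]) \<in> normal_cone C (x0 + h + w)"
  by (force simp: L_map_def image_iff algebra_simps)

text \<open>Pointwise form of the regularity: any preimage of \<open>y1\<close> has a preimage of
  \<open>y2\<close> nearby. The constant is doubled to gain the strict slack for choosing a point;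
  for \<open>y1 = y2\<close> there is no slack, but \<open>x' = x\<close> serves.\<close>

lemma strongly_p_regularE:
  assumes "strongly_p_regular p f C x0 h \<epsilon>"
  obtains c where "c > 0"
    "\<And>y1 y2 t x. 0 < t \<Longrightarrow> t < \<epsilon> \<Longrightarrow> y1 \<in> L_map p f C x0 (t *\<^sub>R h) x \<Longrightarrow>
      \<exists>x'. y2 \<in> L_map p f C x0 (t *\<^sub>R h) x' \<and> norm (x' - x) \<le> c / t ^ (p - 1) * norm (y2 - y1)"
proof -
  obtain c where c: "c > 0"
    and reg: "0 < t \<Longrightarrow> t < \<epsilon> \<Longrightarrow> hausdorff_distance (set_inverse (L_map p f C x0 (t *\<^sub>R h)) y1)
      (set_inverse (L_map p f C x0 (t *\<^sub>R h)) y2) \<le> ennreal (c / t ^ (p - 1) * norm (y1 - y2))"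
    for y1 y2 t
    using assms unfolding strongly_p_regular_def by auto
  have "\<exists>x'. y2 \<in> L_map p f C x0 (t *\<^sub>R h) x' \<and> norm (x' - x) \<le> (2 * c) / t ^ (p - 1) * norm (y2 - y1)"
    if t: "0 < t" "t < \<epsilon>" and x: "y1 \<in> L_map p f C x0 (t *\<^sub>R h) x" for y1 y2 t x
  proof (cases "y1 = y2")
    case True
    then show ?thesis using x by auto
  next
    case False
    then have pos: "c / t ^ (p - 1) * norm (y1 - y2) > 0" using c t by simp
    then have b: "c / t ^ (p - 1) * norm (y1 - y2) < (2 * c) / t ^ (p - 1) * norm (y1 - y2)"
      unfolding times_divide_eq_right[of 2 c, symmetric] mult.assoc
      using less_add_same_cancel1 mult_2 by metis
    obtain x' where "x' \<in> set_inverse (L_map p f C x0 (t *\<^sub>R h)) y2"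
      "dist x x' < (2 * c) / t ^ (p - 1) * norm (y1 - y2)"
      using hausdorff_distance_obtain[OF reg[OF t] _ b less_imp_le[OF pos]] x by (auto simp: set_inverse_def)
    then show ?thesis
      by (intro exI[of _ x']) (auto simp: set_inverse_def dist_norm norm_minus_commute)
  qed
  then show ?thesis using that[of "2 * c"] c by simp
qed

text \<open>Corrections of order t^2 are o(t); what remains is to turn a choice for each t into a
  map on the space.\<close>

lemma tangent_coneI_quadratic:
  fixes S :: "'a::real_normed_vector set"
  assumes x0: "x0 \<in> S" and \<tau>: "\<tau> > 0"
    and ex: "\<And>t. 0 < t \<Longrightarrow> t < \<tau> \<Longrightarrow> \<exists>w. norm w \<le> \<rho> * t ^ 2 \<and> x0 + t *\<^sub>R h + w \<in> S"
  shows "h \<in> tangent_cone S x0"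
proof -
  obtain W where W: "0 < t \<Longrightarrow> t < \<tau> \<Longrightarrow> norm (W t) \<le> \<rho> * t ^ 2 \<and> x0 + t *\<^sub>R h + W t \<in> S" for t
    using ex by metis
  \<comment> \<open>For \<open>h \<noteq> 0\<close> the parameter is recovered as
    \<open>t = norm (t *\<^sub>R h) / norm h\<close>. The value 0 at the origin covers both
    \<open>t = 0\<close> and \<open>h = 0\<close>.\<close>
  define w :: "'a \<Rightarrow> 'a" where "w v = (if v = 0 then 0 else W (norm v / norm h))" for v
  have w: "w (t *\<^sub>R h) = (if h = 0 then 0 else W t)" if "0 < t" for t
    using that by (simp add: w_def)
  have "x0 + t *\<^sub>R h + w (t *\<^sub>R h) \<in> S" if "t \<in> {0..<\<tau>}" for t
  proof (cases "t = 0 \<or> h = 0")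
    case True
    then show ?thesis using x0 by (auto simp: w_def)
  next
    case False
    then show ?thesis using that W[of t] w[of t] by simp
  qed
  moreover have "(\<lambda>t. norm (w (t *\<^sub>R h))) \<in> O[at_right 0](\<lambda>t. t ^ 2)"
  proof (rule bigoI)
    show "\<forall>\<^sub>F t in at_right 0. norm (norm (w (t *\<^sub>R h))) \<le> \<bar>\<rho>\<bar> * norm (t ^ 2)"
      unfolding eventually_at_right_field
    proof (intro exI[of _ \<tau>] conjI allI impI \<tau>)
      fix t :: real assume t: "0 < t" "t < \<tau>"
      have "\<rho> * t ^ 2 \<le> \<bar>\<rho>\<bar> * t ^ 2" by (intro mult_right_mono) auto
      then have "norm (w (t *\<^sub>R h)) \<le> \<bar>\<rho>\<bar> * t ^ 2"
        using order_trans[OF conjunct1[OF W[OF t]]] by (simp add: w[OF t(1)])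
      then show "norm (norm (w (t *\<^sub>R h))) \<le> \<bar>\<rho>\<bar> * norm (t ^ 2)"
        by simp
    qed
  qed
  moreover have "(\<lambda>t::real. t ^ 2) \<in> o[at_right 0](\<lambda>t. t)"
  proof (rule smalloI_tendsto)
    show "((\<lambda>t::real. t ^ 2 / t) \<longlongrightarrow> 0) (at_right 0)"
      by (simp add: power2_eq_square)
    show "\<forall>\<^sub>F t::real in at_right 0. t \<noteq> 0"
      by (simp add: eventually_at_filter)
  qed
  ultimately show ?thesis
    using \<tau> landau_o.big_small_trans unfolding tangent_cone_def mem_Collect_eq by metis
qed

theorem theorem3:
  fixes f :: "'a::banach \<Rightarrow> 'a \<Rightarrow>\<^sub>L real" and C :: "'a set" and x0 h :: 'a and p :: nat and \<epsilon> :: real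
  assumes "C \<noteq> {}" and "closed C" and "convex C"
    and "p \<ge> 2"
    and "C_diff (p + 1) f"
    and "0 \<in> gen_map f C x0"
    and "blinfun_apply (f x0) h = 0"
    and "completely_degenerate p f x0"
    and "\<epsilon> > 0"
    and "\<forall>t\<in>{0..<\<epsilon>}. 0 \<in> L_map p f C x0 (t *\<^sub>R h) 0"
    and "strongly_p_regular p f C x0 h \<epsilon>"
  shows "h \<in> tangent_cone (solution_set (gen_map f C)) x0"
proof -
  have p: "p \<ge> 2" "p - 1 + 1 = p" and Cd: "C_diff (Suc p) f" using assms(4,5) by auto
  let ?L = "\<lambda>t. L_map p f C x0 (t *\<^sub>R h)"
  obtain c where c: "c > 0" and reg: "\<And>y1 y2 t x. 0 < t \<Longrightarrow> t < \<epsilon> \<Longrightarrow> y1 \<in> ?L t x \<Longrightarrow>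
      \<exists>x'. y2 \<in> ?L t x' \<and> norm (x' - x) \<le> c / t ^ (p - 1) * norm (y2 - y1)"
    using strongly_p_regularE[OF assms(11)] by blast
  obtain K d where K: "K > 0" and d: "d > 0" and
    Kd: "\<And>u hs. norm u < d \<Longrightarrow> length hs = p \<Longrightarrow>
      norm (fderiv p f (x0 + u) hs - fderiv p f x0 hs) \<le> K * norm u * (\<Prod>h\<leftarrow>hs. norm h)"
    using C_diff_locally_Lipschitz[OF Cd] by metis
  obtain M where M: "M > 0" and
    Mb: "\<And>hs. length hs = p \<Longrightarrow> norm (fderiv p f x0 hs) \<le> M * (\<Prod>h\<leftarrow>hs. norm h)"
    using bounded_multilinear_boundE[OF C_diff_bounded_multilinear[OF Cd], of p] by auto
  \<comment> \<open>The summand 1 in \<open>H\<close> leaves room for the radius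
    \<open>\<rho> * t ^ 2\<close>, which is at most \<open>t\<close> when
    \<open>t < 1 / \<rho>\<close>. \<open>\<rho>\<close> is twice the constant of the first step,
    \<open>t ^ p * Q\<close> is the Lipschitz constant of \<open>G\<close>, and
    \<open>t < 1 / (2 * c * Q)\<close> makes the contraction factor at most 1/2.\<close>
  define H where "H = norm h + 1"
  define \<rho> where "\<rho> = 2 * c * K * H ^ (p + 1)"
  define Q where "Q = K * H ^ p + M * real (p - 1) * H ^ (p - 2) * \<rho>"
  define \<tau> where "\<tau> = Min {\<epsilon>, d / H, 1 / \<rho>, 1 / (2 * c * Q)}"
  have H: "H > 0" by (simp add: H_def add_nonneg_pos)
  have \<rho>: "\<rho> > 0" using c K H by (simp add: \<rho>_def)
  have Q: "Q > 0" using K M H \<rho> by (simp add: Q_def add_pos_nonneg)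
  have sol0: "- f x0 \<in> normal_cone C x0"
    using assms(6) by (simp add: gen_map_def zero_in_translate_iff)
  show ?thesis
  proof (rule tangent_coneI_quadratic)
    show "x0 \<in> solution_set (gen_map f C)" using assms(6) by (simp add: solution_set_def)
    show "\<tau> > 0" using assms(9) d H \<rho> c Q by (simp add: \<tau>_def)
  next
    fix t assume t: "0 < t" "t < \<tau>"
    have t\<epsilon>: "t < \<epsilon>" and tH: "t * H < d" and t\<rho>: "\<rho> * t < 1" and tQ: "2 * c * Q * t < 1"
      using t H \<rho> c Q by (auto simp: \<tau>_def field_simps)
    define a where "a = t *\<^sub>R h"
    define r where "r = \<rho> * t ^ 2"
    define A where "A w = (1 / fact (p - 1)) *\<^sub>R fderiv p f x0 (replicate (p - 1) a @ [w])" for w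
    define G where "G w = A (a + w) - f (x0 + a + w)" for w
    define \<Phi> where "\<Phi> w = {w'. G w \<in> ?L t w'}" for w
    have "bounded_linear (\<lambda>v. fderiv p f x0 (replicate (p - 1) a @ [v]))"
      using p by (intro bounded_multilinear_bounded_linear_middle[OF C_diff_bounded_multilinear[OF Cd]]) auto
    then have A: "bounded_linear A"
      unfolding A_def by (intro bounded_linear_intros)
    have \<Phi>_iff: "w' \<in> \<Phi> w \<longleftrightarrow> G w - A (a + w') \<in> normal_cone C (x0 + a + w')" for w w'
      by (simp add: \<Phi>_def L_map_iff A_def a_def)
    have "\<rho> * t * t \<le> 1 * t" using t t\<rho> by (intro mult_right_mono) auto
    then have ar: "norm a + r \<le> t * H"
      using t by (simp add: a_def r_def H_def algebra_simps power2_eq_square)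
    have r0: "0 \<le> r" using \<rho> by (simp add: r_def)
    have ad: "norm a < d" and aH: "norm a \<le> t * H" using ar r0 tH by linarith+
    have tp: "t ^ p = t ^ (p - 1) * t" using power_add[of t "p - 1" 1] p(2) by simp
    have tp2: "t ^ p = t ^ (p - 2) * t ^ 2" using power_add[of t "p - 2" 2] p(1) by (simp only: le_add_diff_inverse2)

    have G_Lipschitz: "norm (G w2 - G w1) \<le> t ^ p * Q * norm (w2 - w1)"
      if "w1 \<in> cball 0 r" "w2 \<in> cball 0 r" for w1 w2
    proof -
      \<comment> \<open>By linearity \<open>A a\<close> cancels, which leaves the difference
        estimated in \<open>C_diff_linearization_bound\<close>, used with
        \<open>R = t * H\<close>.\<close>
      have "G w2 - G w1 = - ((f (x0 + a + w2) - A w2) - (f (x0 + a + w1) - A w1))"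
        by (simp add: G_def linear_add[OF bounded_linear.linear[OF A]])
      then have "norm (G w2 - G w1) = norm ((f (x0 + a + w2) - A w2) - (f (x0 + a + w1) - A w1))"
        by (simp only: norm_minus_cancel)
      also have "\<dots> \<le> (K * (t * H) ^ p + M * real (p - 1) * (t * H) ^ (p - 2) * r) * norm (w2 - w1)"
        unfolding A_def
        using K M by (intro C_diff_linearization_bound[OF Cd assms(8) p(1) _ Kd _ Mb ar tH that]) auto
      also have "K * (t * H) ^ p + M * real (p - 1) * (t * H) ^ (p - 2) * r = t ^ p * Q"
        unfolding Q_def r_def power_mult_distrib tp2 by (simp add: algebra_simps)
      finally show ?thesis .
    qed

    obtain w1 where w1: "w1 \<in> \<Phi> 0" "norm (w1 - 0) \<le> (1 - 1/2) * r"
    proof -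
      define P where "P = fderiv p f x0 (replicate p a)"
      have rep: "replicate (p - 1) a @ [a] = replicate p a"
        using p replicate_append_same[of "p - 1" a] by (metis Suc_eq_plus1 replicate_Suc)
      define y where "y = A a - (1 / fact p) *\<^sub>R P - f x0"
      have PN: "- P \<in> normal_cone C (x0 + a)"
      proof -
        have "0 \<in> ?L t 0" using assms(10) t(1) t\<epsilon> by simp
        then show ?thesis
          unfolding zero_in_L_map_iff zero_in_translate_iff P_def a_def[symmetric] rep .
      qed
      then have aC: "x0 + a \<in> C" by (auto simp: normal_cone_def split: if_splits)
      have "- f x0 \<in> normal_cone C (x0 + a)"
        using sol0 aC by (rule normal_cone_move)
          (simp add: a_def assms(7) blinfun.minus_left blinfun.scaleR_right)
      then have "(1 / fact p) *\<^sub>R (- P) + - f x0 \<in> normal_cone C (x0 + a)"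
        using normal_cone_scaleR[OF PN, of "1 / fact p"] by (intro normal_cone_add) auto
      then have "y \<in> ?L t 0"
        by (simp add: L_map_iff y_def A_def a_def)
      from reg[OF t(1) t\<epsilon> this, of "G 0"] obtain w where
        w: "w \<in> \<Phi> 0" "norm (w - 0) \<le> c / t ^ (p - 1) * norm (G 0 - y)"
        by (auto simp: \<Phi>_def)
      \<comment> \<open>With no directions the expansion is that of \<open>f\<close> itself. Since
        \<open>A a\<close> cancels, \<open>G 0 - y\<close> is minus its remainder.\<close>
      let ?e = "[] :: 'a list"
      have "norm (fderiv (length ?e) f (x0 + a) ?e - fderiv (length ?e) f x0 ?e
            - (1 / fact (p - length ?e)) *\<^sub>R fderiv p f x0 (replicate (p - length ?e) a @ ?e))
          \<le> K * norm a ^ Suc (p - length ?e) * (\<Prod>h\<leftarrow>?e. norm h)"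
        using p ad K by (intro C_diff_degenerate_Taylor[OF Cd assms(8) _ _ Kd]) auto
      then have "norm (- (f (x0 + a) - f x0 - (1 / fact p) *\<^sub>R P)) \<le> K * norm a ^ Suc p"
        unfolding norm_minus_cancel by (simp add: P_def)
      then have "norm (G 0 - y) \<le> K * norm a ^ Suc p"
        by (simp add: G_def y_def algebra_simps)
      also have "\<dots> \<le> K * (t * H) ^ Suc p"
        using K aH by (intro mult_left_mono power_mono) auto
      finally have "c / t ^ (p - 1) * norm (G 0 - y) \<le> c / t ^ (p - 1) * (K * (t * H) ^ Suc p)"
        using c t by (intro mult_left_mono) auto
      \<comment> \<open>The powers of \<open>t\<close> combine to \<open>t ^ 2\<close>, and
        \<open>\<rho>\<close> was chosen so that half the radius results, as the contraction factor
        1/2 requires.\<close>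
      also have "\<dots> = (1 - 1/2) * r"
        using t by (simp add: power_mult_distrib tp r_def \<rho>_def power2_eq_square)
      finally show ?thesis using that[OF w(1) order_trans[OF w(2)]] by blast
    qed

    have "\<exists>w\<in>cball 0 r. w \<in> \<Phi> w"
    proof (rule set_valued_contraction_fixpoint[where q = "1/2"])
      fix u u' y :: 'a
      assume u: "u \<in> cball 0 r" "u' \<in> cball 0 r" and y: "y \<in> \<Phi> u"
      then have "G u \<in> ?L t y" by (simp add: \<Phi>_def)
      from reg[OF t(1) t\<epsilon> this, of "G u'"] obtain y' where
        y': "y' \<in> \<Phi> u'" "norm (y' - y) \<le> c / t ^ (p - 1) * norm (G u' - G u)"
        by (auto simp: \<Phi>_def)
      note y'(2)
      \<comment> \<open>The singular factor of the regularity is outweighed by \<open>t ^ p\<close>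
        from \<open>G\<close>, leaving the factor \<open>c * Q * t\<close>.\<close>
      also have "c / t ^ (p - 1) * norm (G u' - G u) \<le> c / t ^ (p - 1) * (t ^ p * Q * norm (u' - u))"
        using c t G_Lipschitz[OF u] by (intro mult_left_mono) auto
      also have "\<dots> = (c * Q * t) * norm (u' - u)"
        using t by (simp add: tp)
      also have "\<dots> \<le> 1/2 * norm (u' - u)"
        using tQ by (intro mult_right_mono) auto
      finally show "\<exists>y'\<in>\<Phi> u'. norm (y' - y) \<le> 1/2 * norm (u' - u)"
        using y'(1) by blast
    next
      fix x y :: "nat \<Rightarrow> 'a" and u
      assume x: "\<And>k. x k \<in> cball 0 r" and y: "\<And>k. y k \<in> \<Phi> (x k)"
        and lim: "x \<longlonglongrightarrow> u" "y \<longlonglongrightarrow> u"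
      \<comment> \<open>The Lipschitz estimate gives continuity of \<open>G\<close> only inside the
        ball, so the limit has to be placed there first.\<close>
      have u: "u \<in> cball 0 r" using closed_cball x lim(1) by (rule closed_sequentially)
      have "(\<lambda>k. G (x k)) \<longlonglongrightarrow> G u"
      proof (rule metric_tendsto_imp_tendsto[OF tendsto_mult_right_zero])
        show "(\<lambda>k. norm (x k - u)) \<longlonglongrightarrow> 0" using lim(1) by (simp add: LIM_zero_iff tendsto_norm_zero)
        show "\<forall>\<^sub>F k in sequentially. dist (G (x k)) (G u) \<le> dist (t ^ p * Q * norm (x k - u)) 0"
          using G_Lipschitz[OF u x] t Q by (simp add: dist_norm)
      qed
      moreover have "(\<lambda>k. A (a + y k)) \<longlonglongrightarrow> A (a + u)"
        by (intro bounded_linear.tendsto[OF A] tendsto_intros lim)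
      ultimately have cone_lim: "(\<lambda>k. G (x k) - A (a + y k)) \<longlonglongrightarrow> G u - A (a + u)"
        by (rule tendsto_diff)
      have point_lim: "(\<lambda>k. x0 + a + y k) \<longlonglongrightarrow> x0 + a + u"
        by (intro tendsto_intros lim)
      show "u \<in> \<Phi> u"
        unfolding \<Phi>_iff using assms(2) y[unfolded \<Phi>_iff] point_lim cone_lim by (rule normal_cone_closed_graph)
    qed (use w1 in auto)
    \<comment> \<open>At a fixed point \<open>A (a + w)\<close> cancels, so the cone contains
      \<open>- f (x0 + a + w)\<close>.\<close>
    then obtain w where "norm w \<le> r" "G w - A (a + w) \<in> normal_cone C (x0 + a + w)"
      by (auto simp: \<Phi>_iff)
    then show "\<exists>w. norm w \<le> \<rho> * t ^ 2 \<and> x0 + t *\<^sub>R h + w \<in> solution_set (gen_map f C)"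
      by (auto simp: G_def solution_set_def gen_map_def zero_in_translate_iff a_def r_def)
  qed
qed

end
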